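(* Let $\mathcal Q$ be a 2-dimensional space form, let $\eta$ be an admissible arc-length parameter for $\mathcal Q$, and let $\kappa:\mathcal V\to\mathbb R$ be any map. Then there exists a curve $f\in\mathcal C_{\mathcal Q}(\eta)$ that has $\kappa$ as its curvature function, and this discrete curve $f$ is unique up to motions of $\mathcal Q$.
   Context: **Light cone model.** $\mathbb R^{3,2}$ is $\mathbb R^5$ with the inner product $\langle\langle x,y\rangle\rangle=x_1y_1+x_2y_2+x_3y_3-x_4y_4-x_5y_5$, and $\mathfrak p=(0,0,0,0,1)$. Points, oriented circles and oriented lines of $\mathbb R^2\cup\{\infty\}$ correspond to null lines $\mathbb R\mathfrak v$, $\mathfrak v\neq0$, $\langle\langle\mathfrak v,\mathfrak v\rangle\rangle=0$: the point $(x,y)$ to $(x,y,\frac12(1-x^2-y^2),\frac12(1+x^2+y^2),0)$, the oriented circle with center $(x,y)$ and radius $r\in\mathbb{R}\setminus\{0\}$ to $(x,y,\frac12(1-x^2-y^2+r^2),\frac12(1+x^2+y^2-r^2),r)$, the oriented line with unit normal $(x,y)$ and normal distance $d$ to $(x,y,-d,d,1)$, and $\infty$ to $(0,0,1,-1,0)$. Points are the null lines orthogonal to $\mathfrak p$. Two elements are in oriented contact (tangency with orientation, or incidence) iff their inner product vanishes. **Space forms.** A space form $\mathcal Q$ is given by a vector $\mathfrak q\neq0$ with $\langle\langle\mathfrak p,\mathfrak q\rangle\rangle=0$; its sectional curvature is $\kappa_{\mathcal Q}=-\langle\langle\mathfrak q,\mathfrak q\rangle\rangle$. The geodesic curvature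 of a circle $\mathfrak s$ is $\langle\langle\mathfrak s,\mathfrak q\rangle\rangle/\langle\langle\mathfrak s,\mathfrak p\rangle\rangle$; geodesics are circles with $\langle\langle\mathfrak s,\mathfrak q\rangle\rangle=0$. Motions of $\mathcal Q$ are the isometries of $\mathcal{Q}$, i.e. compositions of space form reflections $\mathfrak r\mapsto\mathfrak r-\frac{2\langle\langle\mathfrak r,\mathfrak a\rangle\rangle}{\langle\langle\mathfrak a,\mathfrak a\rangle\rangle}\mathfrak a$ with $\langle\langle\mathfrak a,\mathfrak p\rangle\rangle=\langle\langle\mathfrak a,\mathfrak q\rangle\rangle=0$, $\langle\langle\mathfrak a,\mathfrak a\rangle\rangle\ne0$; they act on curve points and on oriented geodesics. **Curves.** $\mathcal V=\mathbb Z$ with edges between consecutive integers; $f_{\bar1},f_0,f_1$ denote values at three consecutive vertices, subscripts $\bar10,01$ the edges between them. $\mathcal C_{\mathcal Q}$ is the set of discrete curves $f:\mathcal V\to\mathcal Q$ with constant distance in $\mathcal Q$ between consecutive points, any three consecutive points pairwise distinct, all points on one side of the hyperbolic boundary if $\kappa_{\mathcal Q}<0$, consecutive points not antipodal if $\kappa_{\mathcal Q}>0$, together with consistently oriented geodesic edges. The point $f$ is lifted to $\mathfrak f$ with $\langle\langle\mathfrak f,\mathfrak q\rangle\rangle=-1$; the oriented geodesic through $f_0,f_1$ is lifted to the null vector $\mathfrak t_{01}$ with $\langle\langle\mathfrak t_{01},\mathfrak p\rangle\rangle=-1$, $\langle\langle\mathfrak t_{01},\mathfrak q\rangle\rangle=\langle\langle\mathfrak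 t_{01},\mathfrak f_0\rangle\rangle=\langle\langle\mathfrak t_{01},\mathfrak f_1\rangle\rangle=0$. Consistent orientation means that at each vertex there is a circle $\mathfrak c_0$ in oriented contact with the geodesic edges at $f_{\bar1}$ and $f_1$, i.e. $\mathfrak c_0=\frac{\kappa_0}{2}\mathfrak f_{\bar1}+\mathfrak t_{\bar10}=\frac{\kappa_0}{2}\mathfrak f_1+\mathfrak t_{01}$ with $\kappa_0\in\mathbb R$. The curvature of $f$ at $f_0$ is this $\kappa_0$, twice the geodesic curvature of $\mathfrak c_0$. $\mathcal C_{\mathcal Q}(\eta)$ is the set of $f\in\mathcal C_{\mathcal Q}$ with $\eta^2=-2\langle\langle\mathfrak f_0,\mathfrak f_1\rangle\rangle$ (a constant along the curve). The parameter $\eta>0$ is admissible if it occurs for two distinct (and, if $\kappa_{\mathcal Q}>0$, non-antipodal) points, i.e. if $\kappa_{\mathcal Q}\,\eta^2<4$. *)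

theory Defs
  imports "HOL-Analysis.Analysis"
begin

definition lip :: "real^5 \<Rightarrow> real^5 \<Rightarrow> real" where
  "lip x y = x$1 * y$1 + x$2 * y$2 + x$3 * y$3 - x$4 * y$4 - x$5 * y$5"

definition pp :: "real^5" where
  "pp = vector [0, 0, 0, 0, 1]"

definition space_form :: "real^5 \<Rightarrow> bool" where
  "space_form q \<longleftrightarrow> q \<noteq> 0 \<and> lip pp q = 0"

definition sectional_curvature :: "real^5 \<Rightarrow> real" where
  "sectional_curvature q = - lip q q"

text \<open>A point of the space form is a null line orthogonal to \<open>pp\<close> and not orthogonal to \<open>q\<close>
  (the null lines orthogonal to both form the hyperbolic boundary, respectively the point at
  infinity of a flat space form). Such a line contains exactly one vector whose product with \<open>q\<close>
  is \<open>-1\<close>, and we represent the point by this vector.\<close>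

definition points :: "real^5 \<Rightarrow> (real^5) set" where
  "points q = {u. lip u u = 0 \<and> lip u pp = 0 \<and> lip u q = -1}"

text \<open>The finite point \<open>(x, y)\<close> has the representative
  \<open>(x, y, (1 - x\<^sup>2 - y\<^sup>2) / 2, (1 + x\<^sup>2 + y\<^sup>2) / 2, 0)\<close> with positive fourth component, and the point
  at infinity has \<open>(0, 0, -1, 1, 0)\<close>. The side of the circle \<open>lip \<cdot> q = 0\<close> on which a point lies is
  the sign of \<open>lip v q\<close>, where \<open>v\<close> is a representative with positive fourth component. Dividing
  by the fourth component makes this independent of the chosen representative.\<close>

definition side :: "real^5 \<Rightarrow> real^5 \<Rightarrow> real" where
  "side q u = sgn (lip u q / u$4)"

text \<open>For positive curvature \<open>k\<close>, the points with their lifts form a round sphere of radius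
  \<open>1 / sqrt k\<close> with center \<open>(1 / k) *\<^sub>R q\<close>.\<close>

definition antipodal :: "real^5 \<Rightarrow> real^5 \<Rightarrow> real^5 \<Rightarrow> bool" where
  "antipodal q u v \<longleftrightarrow> u + v = (2 / sectional_curvature q) *\<^sub>R q"

text \<open>Intrinsic distance of two points (on the same side of the hyperbolic boundary). Here
  \<open>s\<close> is the chord length: \<open>lip (u - v) (u - v) = - 2 * lip u v\<close> for null vectors.\<close>

definition distance :: "real^5 \<Rightarrow> real^5 \<Rightarrow> real^5 \<Rightarrow> real" where
  "distance q u v =
    (let k = sectional_curvature q; s = sqrt (- 2 * lip u v) in
     if k > 0 then 2 / sqrt k * arcsin (sqrt k * s / 2)
     else if k < 0 then 2 / sqrt (- k) * arsinh (sqrt (- k) * s / 2)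
     else s)"

text \<open>Lift of an oriented geodesic through \<open>u\<close> and \<open>v\<close>.\<close>

definition geodesic_edge :: "real^5 \<Rightarrow> real^5 \<Rightarrow> real^5 \<Rightarrow> real^5 \<Rightarrow> bool" where
  "geodesic_edge q u v t \<longleftrightarrow>
     lip t t = 0 \<and> lip t pp = -1 \<and> lip t q = 0 \<and> lip t u = 0 \<and> lip t v = 0"

text \<open>A discrete curve consists of points \<open>f i\<close> and oriented edges \<open>t i\<close>, where \<open>t i\<close> joins
  \<open>f i\<close> and \<open>f (i + 1)\<close>. The following says that \<open>c\<close> is the circle touching the edges
  at \<open>i\<close> in \<open>f (i - 1)\<close> and \<open>f (i + 1)\<close>, with \<open>k\<close> as the curvature at \<open>i\<close>.\<close>

definition vertex_circle ::
  "(int \<Rightarrow> real^5) \<Rightarrow> (int \<Rightarrow> real^5) \<Rightarrow> int \<Rightarrow> real \<Rightarrow> real^5 \<Rightarrow> bool" where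
  "vertex_circle f t i k c \<longleftrightarrow>
     c = (k / 2) *\<^sub>R f (i - 1) + t (i - 1) \<and> c = (k / 2) *\<^sub>R f (i + 1) + t i"

definition curves :: "real^5 \<Rightarrow> ((int \<Rightarrow> real^5) \<times> (int \<Rightarrow> real^5)) set" where
  "curves q = {(f, t).
     (\<forall>i. f i \<in> points q) \<and>
     (\<exists>d. \<forall>i. distance q (f i) (f (i + 1)) = d) \<and>
     (\<forall>i. f (i - 1) \<noteq> f i \<and> f i \<noteq> f (i + 1) \<and> f (i - 1) \<noteq> f (i + 1)) \<and>
     (sectional_curvature q < 0 \<longrightarrow> (\<forall>i j. side q (f i) = side q (f j))) \<and>
     (sectional_curvature q > 0 \<longrightarrow> (\<forall>i. \<not> antipodal q (f i) (f (i + 1)))) \<and>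
     (\<forall>i. geodesic_edge q (f i) (f (i + 1)) (t i)) \<and>
     (\<forall>i. \<exists>k c. vertex_circle f t i k c)}"

definition curves_arclength :: "real^5 \<Rightarrow> real \<Rightarrow> ((int \<Rightarrow> real^5) \<times> (int \<Rightarrow> real^5)) set" where
  "curves_arclength q \<eta> =
     {(f, t). (f, t) \<in> curves q \<and> (\<forall>i. \<eta>\<^sup>2 = - 2 * lip (f i) (f (i + 1)))}"

text \<open>Well defined on \<open>curves q\<close>; see \<open>curvature_eqI\<close> below.\<close>

definition curvature :: "(int \<Rightarrow> real^5) \<Rightarrow> (int \<Rightarrow> real^5) \<Rightarrow> int \<Rightarrow> real" where
  "curvature f t i = (THE k. \<exists>c. vertex_circle f t i k c)"

text \<open>See \<open>admissible_iff\<close> below for the characterization by pairs of points.\<close>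

definition admissible :: "real^5 \<Rightarrow> real \<Rightarrow> bool" where
  "admissible q \<eta> \<longleftrightarrow> \<eta> > 0 \<and> sectional_curvature q * \<eta>\<^sup>2 < 4"

definition reflection :: "real^5 \<Rightarrow> real^5 \<Rightarrow> real^5" where
  "reflection a r = r - (2 * lip r a / lip a a) *\<^sub>R a"

inductive_set motions :: "real^5 \<Rightarrow> (real^5 \<Rightarrow> real^5) set" for q :: "real^5" where
  motion_id: "id \<in> motions q"
| motion_reflection:
    "\<lbrakk>m \<in> motions q; lip a pp = 0; lip a q = 0; lip a a \<noteq> 0\<rbrakk> \<Longrightarrow> reflection a \<circ> m \<in> motions q"

definition geodesic_curvature :: "real^5 \<Rightarrow> real^5 \<Rightarrow> real" where
  "geodesic_curvature q s = lip s q / lip s pp"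


lemma exhaust_5:
  fixes x :: 5
  shows "x = 1 \<or> x = 2 \<or> x = 3 \<or> x = 4 \<or> x = 5"
proof (induct x)
  case (of_int z)
  then have "z = 0 \<or> z = 1 \<or> z = 2 \<or> z = 3 \<or> z = 4" by fastforce
  then show ?case by auto
qed

lemma forall_5: "(\<forall>i::5. P i) \<longleftrightarrow> P 1 \<and> P 2 \<and> P 3 \<and> P 4 \<and> P 5"
  by (metis exhaust_5)

lemma vec5_eq_iff:
  fixes x y :: "real^5"
  shows "x = y \<longleftrightarrow> x$1 = y$1 \<and> x$2 = y$2 \<and> x$3 = y$3 \<and> x$4 = y$4 \<and> x$5 = y$5"
  by (simp add: vec_eq_iff forall_5)

lemma vector_5 [simp]:
  "(vector [a, b, c, d, e] :: real^5) $ 1 = a"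
  "(vector [a, b, c, d, e] :: real^5) $ 2 = b"
  "(vector [a, b, c, d, e] :: real^5) $ 3 = c"
  "(vector [a, b, c, d, e] :: real^5) $ 4 = d"
  "(vector [a, b, c, d, e] :: real^5) $ 5 = e"
  by (simp_all add: vector_def)

lemma lip_commute: "lip x y = lip y x"
  by (simp add: lip_def)

lemma lip_add_left: "lip (x + y) z = lip x z + lip y z"
  and lip_diff_left: "lip (x - y) z = lip x z - lip y z"
  and lip_scaleR_left: "lip (r *\<^sub>R x) z = r * lip x z"
  by (simp_all add: lip_def algebra_simps)

lemma lip_add_right: "lip z (x + y) = lip z x + lip z y"
  and lip_diff_right: "lip z (x - y) = lip z x - lip z y"
  and lip_scaleR_right: "lip z (r *\<^sub>R x) = r * lip z x"
  by (simp_all add: lip_def algebra_simps)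

lemma lip_minus_left: "lip (- x) z = - lip x z"
  and lip_minus_right: "lip z (- x) = - lip z x"
  by (simp_all add: lip_def)

lemmas lip_linear = lip_minus_left lip_minus_right lip_add_left lip_diff_left lip_scaleR_left
  lip_add_right lip_diff_right lip_scaleR_right

lemma lip_pp [simp]: "lip x pp = - x$5" "lip pp x = - x$5"
  by (simp_all add: lip_def pp_def)

lemma sum3_zero:
  fixes a b c :: real
  shows "a\<^sup>2 + b\<^sup>2 + c\<^sup>2 = 0 \<longleftrightarrow> a = 0 \<and> b = 0 \<and> c = 0"
  using add_nonneg_eq_0_iff[of "a\<^sup>2 + b\<^sup>2" "c\<^sup>2"] by simp

lemma sum3_nonneg:
  fixes a b c x y :: real
  assumes "x - y = a\<^sup>2 + b\<^sup>2 + c\<^sup>2"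
  shows "y \<le> x"
proof -
  have "0 \<le> a\<^sup>2 + b\<^sup>2 + c\<^sup>2" by simp
  with assms show ?thesis by linarith
qed

lemma null_4_nonzero:
  assumes "lip u u = 0" "u$5 = 0" "u \<noteq> 0"
  shows "u$4 \<noteq> 0"
proof
  assume "u$4 = 0"
  with assms have "(u$1)\<^sup>2 + (u$2)\<^sup>2 + (u$3)\<^sup>2 = 0"
    by (simp add: lip_def power2_eq_square)
  then have "u$1 = 0" "u$2 = 0" "u$3 = 0"
    by (simp_all add: sum3_zero)
  with assms \<open>u$4 = 0\<close> show False by (simp add: vec5_eq_iff)
qed

lemma curvature_eqI:
  assumes "(f, t) \<in> curves q" "vertex_circle f t i k c"
  shows "curvature f t i = k"
  unfolding curvature_def
proof (rule the_equality)
  show "\<exists>c. vertex_circle f t i k c" using assms by blast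
next
  fix k'
  assume "\<exists>c. vertex_circle f t i k' c"
  then have 1: "(k' / 2) *\<^sub>R f (i - 1) + t (i - 1) = (k' / 2) *\<^sub>R f (i + 1) + t i"
    by (auto simp: vertex_circle_def)
  have 2: "(k / 2) *\<^sub>R f (i - 1) + t (i - 1) = (k / 2) *\<^sub>R f (i + 1) + t i"
    using assms(2) unfolding vertex_circle_def by metis
  have "(k' / 2 - k / 2) *\<^sub>R (f (i - 1) - f (i + 1)) =
      ((k' / 2) *\<^sub>R f (i - 1) + t (i - 1)) - ((k / 2) *\<^sub>R f (i - 1) + t (i - 1))
      - (((k' / 2) *\<^sub>R f (i + 1) + t i) - ((k / 2) *\<^sub>R f (i + 1) + t i))"
    by (simp add: algebra_simps)
  also have "\<dots> = 0" using 1 2 by simp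
  finally show "k' = k" using assms(1) by (auto simp: curves_def)
qed

lemma curvature_eq_twice_geodesic_curvature:
  assumes "(f, t) \<in> curves q" "vertex_circle f t i k c"
  shows "k = 2 * geodesic_curvature q c"
proof -
  have f: "f (i + 1) \<in> points q" and t: "geodesic_edge q (f i) (f (i + 1)) (t i)"
    using assms(1) by (auto simp: curves_def)
  have c: "c = (k / 2) *\<^sub>R f (i + 1) + t i"
    using assms(2) unfolding vertex_circle_def by metis
  have "lip c q = - k / 2" "lip c pp = -1"
    unfolding c lip_linear using f t by (auto simp: points_def geodesic_edge_def)
  then show ?thesis by (simp add: geodesic_curvature_def)
qed

lemma lip_null_nonpos:
  assumes "lip u u = 0" "lip v v = 0" "u$5 = 0" "v$5 = 0" "u$4 * v$4 > 0"
  shows "lip u v \<le> 0"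
proof -
  have u: "(u$1)\<^sup>2 + (u$2)\<^sup>2 + (u$3)\<^sup>2 = (u$4)\<^sup>2" and v: "(v$1)\<^sup>2 + (v$2)\<^sup>2 + (v$3)\<^sup>2 = (v$4)\<^sup>2"
    using assms by (simp_all add: lip_def power2_eq_square)
  have "(u$1 * v$1 + u$2 * v$2 + u$3 * v$3)\<^sup>2 \<le>
      ((u$1)\<^sup>2 + (u$2)\<^sup>2 + (u$3)\<^sup>2) * ((v$1)\<^sup>2 + (v$2)\<^sup>2 + (v$3)\<^sup>2)"
  proof -
    have "((u$1)\<^sup>2 + (u$2)\<^sup>2 + (u$3)\<^sup>2) * ((v$1)\<^sup>2 + (v$2)\<^sup>2 + (v$3)\<^sup>2)
        - (u$1 * v$1 + u$2 * v$2 + u$3 * v$3)\<^sup>2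
      = (u$1 * v$2 - u$2 * v$1)\<^sup>2 + (u$1 * v$3 - u$3 * v$1)\<^sup>2 + (u$2 * v$3 - u$3 * v$2)\<^sup>2"
      by (simp add: power2_eq_square algebra_simps)
    then show ?thesis by (rule sum3_nonneg)
  qed
  then have "(u$1 * v$1 + u$2 * v$2 + u$3 * v$3)\<^sup>2 \<le> (u$4 * v$4)\<^sup>2"
    by (simp add: u v power_mult_distrib)
  then have "u$1 * v$1 + u$2 * v$2 + u$3 * v$3 \<le> u$4 * v$4"
    using assms(5) power2_le_imp_le[of "u$1 * v$1 + u$2 * v$2 + u$3 * v$3" "u$4 * v$4"] by simp
  then show ?thesis using assms by (simp add: lip_def)
qed

lemma spacelike_of_orth_timelike:
  assumes "lip q q < 0" "q$5 = 0" "z$5 = 0" "lip z q = 0" "z \<noteq> 0"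
  shows "lip z z > 0"
proof -
  define Q Z where "Q = (q$1)\<^sup>2 + (q$2)\<^sup>2 + (q$3)\<^sup>2" and "Z = (z$1)\<^sup>2 + (z$2)\<^sup>2 + (z$3)\<^sup>2"
  have q: "Q < (q$4)\<^sup>2" and z: "z$4 * q$4 = z$1 * q$1 + z$2 * q$2 + z$3 * q$3"
    using assms by (simp_all add: lip_def power2_eq_square Q_def)
  have "Z * Q - (z$4 * q$4)\<^sup>2
      = (z$1 * q$2 - z$2 * q$1)\<^sup>2 + (z$1 * q$3 - z$3 * q$1)\<^sup>2 + (z$2 * q$3 - z$3 * q$2)\<^sup>2"
    unfolding z Z_def Q_def by (simp add: power2_eq_square algebra_simps)
  then have ZQ: "(z$4)\<^sup>2 * (q$4)\<^sup>2 \<le> Z * Q"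
    using sum3_nonneg by (fastforce simp: power_mult_distrib)
  have Q0: "Q \<ge> 0" and Z0: "Z \<ge> 0" by (simp_all add: Q_def Z_def)
  have "Z > 0"
  proof (rule ccontr)
    assume "\<not> Z > 0"
    with Z0 have "Z = 0" by simp
    then have "z$1 = 0" "z$2 = 0" "z$3 = 0"
      unfolding Z_def by (simp_all add: sum3_zero)
    moreover have "z$4 = 0"
      using z \<open>z$1 = 0\<close> \<open>z$2 = 0\<close> \<open>z$3 = 0\<close> q Q0 by auto
    ultimately show False using assms by (simp add: vec5_eq_iff)
  qed
  then have "Z * Q < Z * (q$4)\<^sup>2" using q by simp
  with ZQ have "(z$4)\<^sup>2 * (q$4)\<^sup>2 < Z * (q$4)\<^sup>2" by simp
  then have "(z$4)\<^sup>2 < Z" by (simp add: mult_less_cancel_right)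
  then show ?thesis using assms by (simp add: lip_def power2_eq_square Z_def)
qed

lemma exists_point:
  assumes "space_form q"
  shows "\<exists>u. u \<in> points q"
proof -
  have "\<exists>l::real^5. lip l l = 0 \<and> l$5 = 0 \<and> lip l q \<noteq> 0"
  proof (rule ccontr)
    assume "\<not> ?thesis"
    then have H: "lip l q = 0" if "lip l l = 0" "l$5 = 0" for l using that by blast
    have "q$1 = q$4" "- q$1 = q$4" "q$2 = q$4" "q$3 = q$4"
      using H[of "vector [1,0,0,1,0]"] H[of "vector [-1,0,0,1,0]"]
        H[of "vector [0,1,0,1,0]"] H[of "vector [0,0,1,1,0]"]
      by (simp_all add: lip_def)
    with assms show False by (simp add: space_form_def vec5_eq_iff)
  qed
  then obtain l :: "real^5" where "lip l l = 0" "l$5 = 0" "lip l q \<noteq> 0" by blast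
  then have "(- 1 / lip l q) *\<^sub>R l \<in> points q"
    by (simp add: points_def lip_linear)
  then show ?thesis by blast
qed

lemma exists_tangent:
  assumes "u \<in> points q" "q$5 = 0"
  shows "\<exists>T. lip T T > 0 \<and> lip T u = 0 \<and> lip T q = 0 \<and> T$5 = 0"
proof -
  define S :: "real^5" where
    "S = (if u$1 = 0 \<and> u$2 = 0 then vector [1, 0, 0, 0, 0] else vector [- u$2, u$1, 0, 0, 0])"
  have "lip S S > 0"
    using sum_squares_gt_zero_iff[of "u$1" "u$2"] by (auto simp: S_def lip_def add.commute)
  moreover have "lip S u = 0" "S$5 = 0" by (auto simp: S_def lip_def)
  ultimately have "lip (S + lip S q *\<^sub>R u) (S + lip S q *\<^sub>R u) > 0 \<and> lip (S + lip S q *\<^sub>R u) u = 0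
      \<and> lip (S + lip S q *\<^sub>R u) q = 0 \<and> (S + lip S q *\<^sub>R u)$5 = 0"
    using assms by (simp add: points_def lip_linear lip_commute[of u S])
  then show ?thesis by blast
qed

lemma admissible_iff:
  assumes q: "space_form q" and \<eta>: "\<eta> > 0"
  shows "admissible q \<eta> \<longleftrightarrow>
    (\<exists>u\<in>points q. \<exists>v\<in>points q. u \<noteq> v \<and>
      (sectional_curvature q < 0 \<longrightarrow> side q u = side q v) \<and>
      (sectional_curvature q > 0 \<longrightarrow> \<not> antipodal q u v) \<and>
      \<eta>\<^sup>2 = - 2 * lip u v)"
    (is "_ \<longleftrightarrow> ?R")
proof
  define k where "k = sectional_curvature q"
  have q5: "q$5 = 0" using q by (simp add: space_form_def)
  have qq: "lip q q = - k" by (simp add: k_def sectional_curvature_def)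
  {
    assume "admissible q \<eta>"
    then have k4: "k * \<eta>\<^sup>2 < 4" by (simp add: admissible_def k_def)
    obtain u where u: "u \<in> points q" using exists_point[OF q] by blast
    obtain T where T: "lip T T > 0" "lip T u = 0" "lip T q = 0" "T$5 = 0"
      using exists_tangent[OF u q5] by blast
    define a b g where "a = 1 - k * \<eta>\<^sup>2 / 4" and "b = \<eta>\<^sup>2 / 2" and "g = sqrt (2 * a * b / lip T T)"
    define v where "v = a *\<^sub>R u + b *\<^sub>R (q - (k / 2) *\<^sub>R u) + g *\<^sub>R T"
    have a0: "a > 0" and b0: "b > 0" using k4 \<eta> by (auto simp: a_def b_def)
    have g: "g * g * lip T T = 2 * a * b"
      using a0 b0 T(1) by (simp add: g_def)
    have u0: "lip u u = 0" "lip u q = -1" "lip q u = -1" "u$5 = 0"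
      using u by (auto simp: points_def lip_commute)
    have T': "lip u T = 0" "lip q T = 0" using T by (simp_all add: lip_commute)
    have uv: "lip u v = - b" unfolding v_def by (simp add: lip_linear u0 T')
    have "lip v q = - a + b * (- k + k / 2)"
      unfolding v_def by (simp add: lip_linear u0 T qq)
    then have vq: "lip v q = -1" by (simp add: a_def b_def field_simps)
    have "lip v v = - 2 * a * b + g * g * lip T T"
      unfolding v_def by (simp add: lip_linear u0 T T' qq algebra_simps)
    then have vv: "lip v v = 0" using g by simp
    have v5: "v$5 = 0" unfolding v_def by (simp add: u0 T q5)
    have v: "v \<in> points q" using vv vq v5 by (simp add: points_def)
    have ne: "u \<noteq> v" using uv u0 b0 by auto
    have "u \<noteq> 0" using u0 by (auto simp: lip_def)
    have "v \<noteq> 0" using vq by (auto simp: lip_def)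
    have "side q u = side q v"
    proof -
      have "u$4 \<noteq> 0" "v$4 \<noteq> 0"
        using null_4_nonzero u0 vv v5 \<open>u \<noteq> 0\<close> \<open>v \<noteq> 0\<close> by auto
      moreover have "\<not> u$4 * v$4 < 0"
      proof
        assume "u$4 * v$4 < 0"
        then have "lip u (- 1 *\<^sub>R v) \<le> 0"
          using u0 vv v5 by (intro lip_null_nonpos) (auto simp: lip_linear)
        then show False using uv b0 by (simp add: lip_linear)
      qed
      ultimately show ?thesis
        by (auto simp: side_def vq u0 sgn_if mult_less_0_iff divide_less_0_iff zero_less_divide_iff)
    qed
    moreover have "\<not> antipodal q u v" if "k > 0"
    proof
      assume "antipodal q u v"
      then have "lip u (u + v) = lip u ((2 / k) *\<^sub>R q)" by (simp add: antipodal_def k_def)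
      then have "k * \<eta>\<^sup>2 = 4" using that by (simp add: lip_linear u0 uv b_def field_simps)
      with k4 show False by simp
    qed
    ultimately show ?R using u v ne uv unfolding k_def b_def by force
  }
  {
    assume ?R
    then obtain u v where u: "u \<in> points q" and v: "v \<in> points q"
      and na: "k > 0 \<longrightarrow> \<not> antipodal q u v" and uv: "\<eta>\<^sup>2 = - 2 * lip u v"
      unfolding k_def by blast
    have "k * \<eta>\<^sup>2 < 4"
    proof (cases "k > 0")
      case True
      define z where "z = u + v - (2 / k) *\<^sub>R q"
      have uv0: "lip u u = 0" "lip u q = -1" "lip q u = -1" "u$5 = 0"
          "lip v v = 0" "lip v q = -1" "lip q v = -1" "v$5 = 0"
        using u v by (auto simp: points_def lip_commute)
      have "z \<noteq> 0" using na True by (auto simp: z_def antipodal_def k_def)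
      moreover have "z$5 = 0" "lip z q = 0"
        unfolding z_def using True by (simp_all add: lip_linear uv0 q5 qq)
      ultimately have "lip z z > 0"
        using True by (intro spacelike_of_orth_timelike[OF _ q5]) (auto simp: qq)
      moreover have "lip z z = 4 / k - \<eta>\<^sup>2"
        unfolding z_def using True
        by (simp add: lip_linear uv0 qq uv lip_commute[of v u] field_simps)
      ultimately show ?thesis using True by (simp add: field_simps)
    next
      case False
      then show ?thesis 
        using mult_nonpos_nonneg[of k "\<eta>\<^sup>2"] by simp
    qed
    then show "admissible q \<eta>" using \<eta> by (simp add: admissible_def k_def)
  }
qed

end

theory Submission
  imports Defs
begin

text \<open>At a vertex, the neighbouring edges are exchanged by the reflection in a vector \<open>w\<close>
  orthogonal to \<open>pp\<close>, \<open>q\<close>, the vertex and the vertex circle. These four vectors determine the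
  line spanned by \<open>w\<close>, and \<open>w\<close> turns out to be spacelike and not orthogonal to the previous
  point. So an oriented edge and the curvature at one of its ends determine the edge on the other
  side, and a curve is determined by one edge together with the curvature function. Since
  reflections in differences of vectors act transitively on the oriented edges of a given length,
  the curve is unique up to motions.\<close>

section \<open>Oriented geodesic edges in terms of their lifts\<close>

text \<open>The parameter \<open>b\<close> is half the squared chord length, so
  \<open>b = \<eta>\<^sup>2 / 2\<close> for arc-length parameter \<open>\<eta>\<close>.\<close>

definition edge :: "real^5 \<Rightarrow> real \<Rightarrow> real^5 \<Rightarrow> real^5 \<Rightarrow> real^5 \<Rightarrow> bool" where
  "edge q b u v t \<longleftrightarrow> u \<in> points q \<and> v \<in> points q \<and> lip u v = - b \<and> geodesic_edge q u v t"

text \<open>The orientation is carried by \<open>t\<close>, not by the order of the end points.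
  Hence a curve can be continued backwards by the same step as forwards.\<close>

lemma edge_sym: "edge q b u v t \<longleftrightarrow> edge q b v u t"
  by (auto simp: edge_def geodesic_edge_def lip_commute)

lemma edgeD:
  assumes "edge q b u v t"
  shows "lip u u = 0" "lip v v = 0" "lip t t = 0" "lip u v = - b" "lip v u = - b"
    "lip u q = -1" "lip v q = -1" "lip q u = -1" "lip q v = -1" "lip t q = 0" "lip q t = 0"
    "lip t u = 0" "lip u t = 0" "lip t v = 0" "lip v t = 0" "u$5 = 0" "v$5 = 0" "t$5 = 1"
  using assms by (auto simp: edge_def geodesic_edge_def points_def lip_commute)

lemma edgeI:
  assumes "lip u u = 0" "lip v v = 0" "lip t t = 0" "lip u v = - b" "lip u q = -1" "lip v q = -1"
    "lip t q = 0" "lip t u = 0" "lip t v = 0" "u$5 = 0" "v$5 = 0" "t$5 = 1"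
  shows "edge q b u v t"
  using assms by (auto simp: edge_def geodesic_edge_def points_def)

section \<open>Reflections and motions\<close>

lemma linear_reflection: "linear (reflection a)"
  by (rule linearI)
    (simp_all add: reflection_def lip_linear algebra_simps add_divide_distrib)

lemma reflection_fixes: "lip r a = 0 \<Longrightarrow> reflection a r = r"
  by (simp add: reflection_def)

lemma lip_reflection:
  assumes "lip a a \<noteq> 0"
  shows "lip (reflection a x) (reflection a y) = lip x y"
proof -
  have "lip (reflection a x) (reflection a y) = lip x y - 2 * lip x a / lip a a * lip y a
      - 2 * lip y a / lip a a * (lip x a - 2 * lip x a / lip a a * lip a a)"
    unfolding reflection_def lip_linear lip_commute[of a y] ..
  then show ?thesis using assms by (simp add: field_simps)
qed

text \<open>Equal norms give \<open>2 * lip x (x - y) = lip (x - y) (x - y)\<close>, so the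
  reflection subtracts exactly \<open>x - y\<close> from \<open>x\<close>.\<close>

lemma reflection_diff:
  assumes "lip x x = lip y y" "lip (x - y) (x - y) \<noteq> 0"
  shows "reflection (x - y) x = y"
proof -
  have "2 * lip x (x - y) = lip (x - y) (x - y)"
    using assms(1) by (simp add: lip_linear lip_commute)
  with assms(2) show ?thesis by (simp add: reflection_def)
qed

lemma reflection_inj:
  assumes "lip a a \<noteq> 0"
  shows "inj (reflection a)"
proof (rule inj_on_inverseI)
  fix x
  have "lip (reflection a x) a = - lip x a"
    using assms by (simp add: reflection_def lip_linear)
  then show "reflection a (reflection a x) = x"
    unfolding reflection_def[of a "reflection a x"] by (simp add: reflection_def)
qed

lemma reflection_in_motions:
  assumes "a$5 = 0" "lip a q = 0" "lip a a \<noteq> 0"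
  shows "reflection a \<in> motions q"
  using motion_reflection[OF motion_id, of a q] assms by simp

lemma motions_comp: "m \<in> motions q \<Longrightarrow> n \<in> motions q \<Longrightarrow> m \<circ> n \<in> motions q"
  by (induction rule: motions.induct) (simp_all add: comp_assoc motion_reflection)

lemma motions_linear: "m \<in> motions q \<Longrightarrow> linear m"
proof (induction rule: motions.induct)
  case (motion_reflection m a)
  then show ?case by (intro linear_compose linear_reflection)
qed (rule linear_id)

lemma motions_lip:
  assumes "m \<in> motions q"
  shows "lip (m x) (m y) = lip x y"
  using assms by (induction rule: motions.induct) (simp_all add: lip_reflection)

lemma motions_fix:
  assumes "m \<in> motions q"
  shows "m q = q" "m pp = pp"
  using assms
  by (induction rule: motions.induct) (simp_all add: reflection_fixes lip_commute[of _ q])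

lemma motions_inj: "m \<in> motions q \<Longrightarrow> inj m"
proof (induction rule: motions.induct)
  case (motion_reflection m a)
  then show ?case by (intro inj_compose reflection_inj)
qed (rule inj_on_id)

lemma motions_edge:
  assumes m: "m \<in> motions q" and e: "edge q b u v t"
  shows "edge q b (m u) (m v) (m t)"
proof -
  have "lip (m x) q = lip x q" "(m x)$5 = x$5" for x
    using motions_lip[OF m, of x q] motions_lip[OF m, of x pp] by (simp_all add: motions_fix[OF m])
  then show ?thesis
    by (intro edgeI) (simp_all add: motions_lip[OF m] edgeD[OF e])
qed

section \<open>Null vectors, and transitivity of the motions on oriented edges\<close>

text \<open>Subtracting the multiple of \<open>u\<close> that cancels the fourth coordinate leaves a
  null vector on which \<open>lip\<close> is a sum of three squares, hence zero.\<close>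

lemma null_orthogonal_proportional:
  assumes "lip u u = 0" "lip v v = 0" "lip u v = 0" "u$5 = 0" "v$5 = 0" "u \<noteq> 0"
  shows "v = (v$4 / u$4) *\<^sub>R u"
proof -
  have "u$4 \<noteq> 0" using null_4_nonzero assms by blast
  then have "(v - (v$4 / u$4) *\<^sub>R u)$4 = 0" by simp
  moreover have "lip (v - (v$4 / u$4) *\<^sub>R u) (v - (v$4 / u$4) *\<^sub>R u) = 0"
    by (simp add: lip_linear assms lip_commute[of v u])
  moreover have "(v - (v$4 / u$4) *\<^sub>R u)$5 = 0" using assms by simp
  ultimately show ?thesis using null_4_nonzero eq_iff_diff_eq_0 by blast
qed

text \<open>Orthogonal lifts would be proportional, and the common normalization against
  \<open>q\<close> forces the factor 1.\<close>

lemma points_lip_nonzero: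
  assumes "u \<in> points q" "v \<in> points q" "u \<noteq> v"
  shows "lip u v \<noteq> 0"
proof
  assume 0: "lip u v = 0"
  have "u \<noteq> 0" using assms by (auto simp: points_def lip_def)
  then have v: "v = (v$4 / u$4) *\<^sub>R u"
    using 0 assms by (intro null_orthogonal_proportional) (auto simp: points_def)
  then have "lip v q = (v$4 / u$4) * lip u q" by (metis lip_scaleR_left)
  then have "v$4 / u$4 = 1" using assms by (simp add: points_def)
  with v assms(3) show False by simp
qed

lemma points_motion:
  assumes "u \<in> points q" "v \<in> points q" "u \<noteq> v"
  shows "reflection (u - v) \<in> motions q" "reflection (u - v) u = v"
proof -
  have "lip (u - v) (u - v) \<noteq> 0"
    using points_lip_nonzero[OF assms] assms
    by (simp add: points_def lip_linear lip_commute[of v u])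
  then show "reflection (u - v) \<in> motions q" "reflection (u - v) u = v"
    using assms by (auto intro!: reflection_in_motions reflection_diff simp: points_def lip_linear)
qed

text \<open>The vector \<open>u + v\<close> is timelike, with norm \<open>- 2 * b\<close>, and the
  orthogonal complement of \<open>pp\<close> is Lorentzian.\<close>

lemma edge_orthogonal_spacelike:
  assumes "edge q b u v t" "b > 0" "lip z u = 0" "lip z v = 0" "z$5 = 0" "z \<noteq> 0"
  shows "lip z z > 0"
  using assms
  by (intro spacelike_of_orth_timelike[of "u + v"]) (simp_all add: lip_linear edgeD[OF assms(1)])

text \<open>Three reflections in differences match first \<open>u\<close>, then \<open>v\<close>,
  then \<open>t\<close>. Each later difference is orthogonal to what is already matched, so nothing
  is moved away again.\<close>

lemma motions_transitive:
  assumes e: "edge q b u v t" and e': "edge q b u' v' t'" and b: "b > 0"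
  shows "\<exists>m\<in>motions q. m u = u' \<and> m v = v' \<and> m t = t'"
proof -
  have "\<exists>m\<in>motions q. m u = u'"
  proof (cases "u = u'")
    case False
    then show ?thesis using points_motion[of u q u'] e e' by (auto simp: edge_def)
  qed (auto intro!: bexI[of _ id] motion_id)
  then obtain m where m: "m \<in> motions q" "m u = u'" by blast
  have e1: "edge q b u' (m v) (m t)" using motions_edge[OF m(1) e] m(2) by simp
  have "\<exists>n\<in>motions q. n u' = u' \<and> n (m v) = v'"
  proof (cases "m v = v'")
    case False
    have "lip u' (m v - v') = 0" by (simp add: lip_linear edgeD[OF e1] edgeD[OF e'])
    then show ?thesis
      using points_motion[of "m v" q v'] False e1 e' reflection_fixes by (auto simp: edge_def)
  qed (auto intro!: bexI[of _ id] motion_id)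
  then obtain n where n: "n \<in> motions q" "n u' = u'" "n (m v) = v'" by blast
  have e2: "edge q b u' v' (n (m t))" using motions_edge[OF n(1) e1] n by simp
  have "\<exists>l\<in>motions q. l u' = u' \<and> l v' = v' \<and> l (n (m t)) = t'"
  proof (cases "n (m t) = t'")
    case False
    \<comment> \<open>Both lifts have fifth coordinate 1, so \<open>a\<close> is orthogonal to
      \<open>pp\<close> as well as to both end points; being nonzero it is spacelike, and its
      reflection is a motion.\<close>
    define a where "a = n (m t) - t'"
    have a: "lip a u' = 0" "lip a v' = 0" "lip a q = 0" "a$5 = 0"
      by (simp_all add: a_def lip_linear edgeD[OF e2] edgeD[OF e'])
    have "lip a a > 0"
      using edge_orthogonal_spacelike[OF e' b a(1,2,4)] False by (simp add: a_def)
    then have aa: "lip a a \<noteq> 0" by simp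
    have "reflection a (n (m t)) = t'"
      using aa unfolding a_def by (intro reflection_diff) (simp_all add: edgeD[OF e2] edgeD[OF e'])
    then show ?thesis
      using reflection_in_motions[OF a(4,3) aa] a reflection_fixes lip_commute by metis
  qed (auto intro!: bexI[of _ id] motion_id)
  then obtain l where l: "l \<in> motions q" "l u' = u'" "l v' = v'" "l (n (m t)) = t'" by blast
  show ?thesis
    using m n l by (intro bexI[of _ "l \<circ> (n \<circ> m)"]) (auto intro: motions_comp)
qed

section \<open>Linear algebra of orthogonality in dimension five\<close>

lemma linear_lip_vector:
  "linear (\<lambda>y. vector [lip y a, lip y b, lip y c, lip y d, lip y e] :: real^5)"
  by (rule linearI) (simp_all add: vec5_eq_iff lip_linear)

text \<open>The orthogonal expansion is a right inverse of the map taking the five products. A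
  surjective endomorphism in finite dimension is injective.\<close>

lemma orthogonal_basis_nondegenerate:
  assumes "lip a a \<noteq> 0" "lip b b \<noteq> 0" "lip c c \<noteq> 0" "lip d d \<noteq> 0" "lip e e \<noteq> 0"
    and "lip a b = 0" "lip a c = 0" "lip a d = 0" "lip a e = 0" "lip b c = 0" "lip b d = 0"
      "lip b e = 0" "lip c d = 0" "lip c e = 0" "lip d e = 0"
    and "lip z a = 0" "lip z b = 0" "lip z c = 0" "lip z d = 0" "lip z e = 0"
  shows "z = 0"
proof -
  let ?L = "\<lambda>y. vector [lip y a, lip y b, lip y c, lip y d, lip y e] :: real^5"
  have "surj ?L"
  proof (rule surjI)
    fix y :: "real^5"
    show "?L ((y$1 / lip a a) *\<^sub>R a + (y$2 / lip b b) *\<^sub>R b + (y$3 / lip c c) *\<^sub>R c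
      + (y$4 / lip d d) *\<^sub>R d + (y$5 / lip e e) *\<^sub>R e) = y"
      using assms by (simp add: vec5_eq_iff lip_linear lip_commute)
  qed
  then have "inj ?L" using linear_lip_vector linear_surjective_imp_injective by blast
  moreover have "?L z = ?L 0" using assms by (simp add: lip_def)
  ultimately show ?thesis by (meson injD)
qed

lemma exists_orthogonal:
  "\<exists>z. z \<noteq> 0 \<and> lip z a = 0 \<and> lip z b = 0 \<and> lip z c = 0 \<and> lip z d = 0"
proof -
  \<comment> \<open>The last slot is paired with 0, so the image misses the last unit vector and the
    kernel is nontrivial.\<close>
  let ?L = "\<lambda>y. vector [lip y a, lip y b, lip y c, lip y d, lip y 0] :: real^5"
  have "?L y \<noteq> vector [0, 0, 0, 0, 1]" for y
    by (simp add: vec5_eq_iff lip_def)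
  then have "\<not> surj ?L" unfolding surj_def by metis
  moreover have lin: "linear ?L" by (rule linear_lip_vector)
  ultimately have "\<not> inj ?L" using linear_injective_imp_surjective by blast
  then obtain z where "z \<noteq> 0" "?L z = 0"
    unfolding linear_injective_0[OF lin] by blast
  then show ?thesis by (auto simp: vec5_eq_iff)
qed

section \<open>The step from an edge to its neighbour across a vertex\<close>

text \<open>With \<open>b = \<eta>\<^sup>2 / 2\<close>, \<open>b_less\<close> is the admissibility
  bound on \<open>\<eta>\<close>.\<close>

locale arclength =
  fixes q :: "real^5" and b :: real
  assumes q5: "q$5 = 0" and b_pos: "b > 0" and b_less: "sectional_curvature q * b < 2"
begin

text \<open>The vectors \<open>pp\<close>, \<open>q\<close>, \<open>u\<close>, \<open>v\<close>,
  \<open>t\<close> form a basis, which is seen by orthogonalizing them.\<close>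

lemma edge_nondegenerate:
  assumes e: "edge q b u v t"
    and z: "z$5 = 0" "lip z q = 0" "lip z u = 0" "lip z v = 0" "lip z t = 0"
  shows "z = 0"
proof -
  \<comment> \<open>This is the component of \<open>q\<close> orthogonal to \<open>u\<close> and
    \<open>v\<close>; the strict bound \<open>b_less\<close> makes it nonnull.\<close>
  define r where "r = q - (1 / b) *\<^sub>R (u + v)"
  note simps = lip_linear edgeD[OF e] z q5 r_def
  have "lip r r = (2 - sectional_curvature q * b) / b"
    using b_pos by (simp add: simps sectional_curvature_def field_simps)
  then have 1: "lip r r \<noteq> 0" using b_less b_pos by simp
  have 2: "lip (u + v) (u + v) \<noteq> 0" "lip (u - v) (u - v) \<noteq> 0" "lip (u + v) (u - v) = 0"
    "lip pp (u + v) = 0" "lip pp (u - v) = 0" "lip pp r = 0" "lip (u - v) r = 0" "lip (u + v) r = 0"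
    using b_pos by (simp_all add: simps)
  have 3: "lip pp pp \<noteq> 0" "lip pp (t - pp) = 0" "lip (t - pp) (t - pp) \<noteq> 0"
    "lip (t - pp) (u + v) = 0" "lip (t - pp) (u - v) = 0" "lip (t - pp) r = 0"
    by (simp_all add: simps) (simp_all add: pp_def edgeD[OF e])
  have 4: "lip z pp = 0" "lip z (t - pp) = 0" "lip z (u + v) = 0" "lip z (u - v) = 0" "lip z r = 0"
    by (simp_all add: simps)
  show ?thesis
    using 1 2 3 4
    by (intro orthogonal_basis_nondegenerate[of pp "t - pp" "u + v" "u - v" r z])
qed

text \<open>The mirror vector is a combination of the edge direction \<open>h\<close> and the unit
  normal \<open>t - pp\<close>. Since \<open>lip h u = 2 * a * b\<close> and
  \<open>lip (t - pp) t = 1\<close>, the coefficient \<open>k * a * b\<close> is the one that makes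
  it orthogonal to the vertex circle. Admissibility enters as \<open>a > 0\<close>.\<close>

lemma exists_vertex_reflection:
  assumes e: "edge q b u v t"
  shows "\<exists>w. w$5 = 0 \<and> lip w q = 0 \<and> lip w v = 0 \<and> lip w w > 0 \<and> lip w u \<noteq> 0 \<and>
    lip w ((k / 2) *\<^sub>R u + t) = 0"
proof -
  define K a where "K = sectional_curvature q" and "a = 1 - K * b / 2"
  have a: "a > 0" using b_less by (simp add: a_def K_def)
  have qq: "lip q q = - K" by (simp add: K_def sectional_curvature_def)
  define h where "h = u - a *\<^sub>R v - b *\<^sub>R (q - (K / 2) *\<^sub>R v)"
  \<comment> \<open>\<open>h\<close> is tangent to the space form at \<open>v\<close> along the edge, \<open>t - pp\<close> is the unit normal of the edge.\<close>
  define w where "w = h - (k * a * b) *\<^sub>R (t - pp)"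
  have h5: "h$5 = 0" by (simp add: h_def edgeD[OF e] q5)
  have hu: "lip h u = 2 * a * b" and hv: "lip h v = 0" and hq: "lip h q = 0" and ht: "lip h t = 0"
    unfolding h_def by (simp_all add: lip_linear edgeD[OF e] qq) (simp_all add: a_def field_simps)
  have hh: "lip h h = 2 * a * b"
    by (subst (2) h_def) (simp add: lip_linear hu hv hq)
  have th: "lip t h = 0" using ht by (simp add: lip_commute)
  have pp5: "pp$5 = 1" by (simp add: pp_def)
  have "lip w w = 2 * a * b + (k * a * b)\<^sup>2"
    unfolding w_def by (simp add: lip_linear edgeD[OF e] hh ht th h5 pp5 power2_eq_square)
  then have "lip w w > 0" using a b_pos by (simp add: add_pos_nonneg)
  moreover have "w$5 = 0" "lip w q = 0" "lip w v = 0" "lip w u = 2 * a * b"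
    "lip w t = - (k * a * b)"
    unfolding w_def by (simp_all add: lip_linear edgeD[OF e] h5 pp5 hq hv hu ht q5)
  ultimately show ?thesis using a b_pos by (intro exI[of _ w]) (simp add: lip_linear)
qed

text \<open>The reflection fixes \<open>v\<close> and the circle, so it yields a neighbouring edge.
  Conversely, \<open>x - u\<close> is orthogonal to \<open>pp\<close>, \<open>q\<close>,
  \<open>v\<close> and the circle, which leaves only the line of \<open>w\<close>; on it, the null
  condition on \<open>x\<close> has just one solution besides \<open>u\<close>.\<close>

lemma vertex_reflection_next_edge:
  assumes e: "edge q b u v t"
    and w: "w$5 = 0" "lip w q = 0" "lip w v = 0" "lip w w > 0" "lip w u \<noteq> 0"
      "lip w ((k / 2) *\<^sub>R u + t) = 0"
  shows "edge q b v x s \<and> x \<noteq> u \<and> (k / 2) *\<^sub>R u + t = (k / 2) *\<^sub>R x + s \<longleftrightarrow>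
    x = reflection w u \<and> s = reflection w t" (is "?L \<longleftrightarrow> ?R")
proof -
  have w0: "lip w w \<noteq> 0" using w by simp
  have lin: "(k / 2) *\<^sub>R reflection w u + reflection w t = (k / 2) *\<^sub>R u + t"
  proof -
    have "(k / 2) *\<^sub>R reflection w u + reflection w t = reflection w ((k / 2) *\<^sub>R u + t)"
      using linear_reflection[of w] by (simp add: linear_add linear_scale)
    also have "\<dots> = (k / 2) *\<^sub>R u + t"
      using w by (intro reflection_fixes) (simp add: lip_commute)
    finally show ?thesis .
  qed
  show ?thesis
  proof
    assume ?R
    have "edge q b (reflection w u) v (reflection w t)"
      using motions_edge[OF reflection_in_motions[OF w(1,2) w0] e] reflection_fixes w(3)
      by (metis lip_commute)
    moreover have "reflection w u \<noteq> u"
      using w by (auto simp: reflection_def lip_commute[of u w] lip_def[of 0])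
    ultimately show ?L using \<open>?R\<close> lin edge_sym by metis
  next
    assume L: ?L
    then have e': "edge q b v x s" and ne: "x \<noteq> u"
      and c: "(k / 2) *\<^sub>R u + t = (k / 2) *\<^sub>R x + s" by auto
    \<comment> \<open>The factor \<open>l\<close> makes \<open>d - l *\<^sub>R w\<close> orthogonal
      to \<open>u\<close>. Orthogonality to the circle then gives orthogonality to \<open>t\<close>,
      and \<open>edge_nondegenerate\<close> applies.\<close>
    define d l where "d = x - u" and "l = lip d u / lip w u"
    have "lip d ((k / 2) *\<^sub>R u + t) = lip x ((k / 2) *\<^sub>R x + s) - lip u ((k / 2) *\<^sub>R u + t)"
      unfolding d_def lip_diff_left c ..
    then have dc: "lip d ((k / 2) *\<^sub>R u + t) = 0"
      by (simp add: lip_linear edgeD[OF e] edgeD[OF e'])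
    have zu: "lip (d - l *\<^sub>R w) u = 0" using w by (simp add: lip_linear l_def)
    have "lip (d - l *\<^sub>R w) ((k / 2) *\<^sub>R u + t) = 0"
      using dc w(6) by (simp add: lip_diff_left lip_scaleR_left)
    then have zt: "lip (d - l *\<^sub>R w) t = 0" using zu by (simp add: lip_add_right lip_scaleR_right)
    have "(d - l *\<^sub>R w)$5 = 0" "lip (d - l *\<^sub>R w) q = 0" "lip (d - l *\<^sub>R w) v = 0"
      by (simp_all add: d_def lip_linear w edgeD[OF e] edgeD[OF e'])
    from edge_nondegenerate[OF e this(1,2) zu this(3) zt] have x: "x = u + l *\<^sub>R w"
      by (simp add: d_def algebra_simps)
    \<comment> \<open>The root \<open>l = 0\<close> is the excluded case \<open>x = u\<close>; the
      other root is the coefficient of the reflection.\<close>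
    have "lip x x = l * (2 * lip u w + l * lip w w)"
      unfolding x by (simp add: lip_linear edgeD[OF e] lip_commute[of w u] algebra_simps)
    moreover have "l \<noteq> 0" using ne x by auto
    ultimately have "2 * lip u w + l * lip w w = 0" by (simp add: edgeD[OF e'])
    then have "l = - (2 * lip u w / lip w w)" using w0 by (simp add: field_simps)
    then have xr: "x = reflection w u" using x by (simp add: reflection_def)
    then show ?R using c lin by (metis add_left_cancel)
  qed
qed

lemma next_edge:
  assumes "edge q b u v t"
  shows "\<exists>x s. edge q b v x s \<and> x \<noteq> u \<and> (k / 2) *\<^sub>R u + t = (k / 2) *\<^sub>R x + s"
proof -
  obtain w where "w$5 = 0" "lip w q = 0" "lip w v = 0" "lip w w > 0" "lip w u \<noteq> 0"
    "lip w ((k / 2) *\<^sub>R u + t) = 0"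
    using exists_vertex_reflection[OF assms] by blast
  from vertex_reflection_next_edge[OF assms this] show ?thesis by blast
qed

lemma next_edge_unique:
  assumes "edge q b u v t"
    and "edge q b v x s" "x \<noteq> u" "(k / 2) *\<^sub>R u + t = (k / 2) *\<^sub>R x + s"
    and "edge q b v x' s'" "x' \<noteq> u" "(k / 2) *\<^sub>R u + t = (k / 2) *\<^sub>R x' + s'"
  shows "x = x' \<and> s = s'"
proof -
  obtain w where "w$5 = 0" "lip w q = 0" "lip w v = 0" "lip w w > 0" "lip w u \<noteq> 0"
    "lip w ((k / 2) *\<^sub>R u + t) = 0"
    using exists_vertex_reflection[OF assms(1)] by blast
  note vertex_reflection_next_edge[OF assms(1) this]
  from this[of x s] this[of x' s'] show ?thesis using assms(2-) by simp
qed

section \<open>Existence of single edges, and the side and antipodality conditions on them\<close>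

text \<open>A unit normal \<open>z\<close> of the span of \<open>pp\<close>, \<open>q\<close>,
  \<open>u\<close>, \<open>v\<close> becomes null after adding \<open>pp\<close>, whose norm is -1.
  The sign of \<open>z\<close> decides the orientation.\<close>

lemma exists_geodesic_edge:
  assumes "u \<in> points q" "v \<in> points q" "lip u v = - b"
  shows "\<exists>t. edge q b u v t"
proof -
  obtain z where z: "z \<noteq> 0" "lip z pp = 0" "lip z q = 0" "lip z u = 0" "lip z v = 0"
    using exists_orthogonal by blast
  have "lip z z > 0"
    using assms z b_pos
    by (intro spacelike_of_orth_timelike[of "u + v"])
      (simp_all add: lip_linear points_def lip_commute[of v u])
  then have "lip ((1 / sqrt (lip z z)) *\<^sub>R z) ((1 / sqrt (lip z z)) *\<^sub>R z) = 1"
    by (simp add: lip_linear)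
  moreover have "pp$5 = 1" by (simp add: pp_def)
  ultimately have "edge q b u v ((1 / sqrt (lip z z)) *\<^sub>R z + pp)"
    using assms z q5 by (intro edgeI) (simp_all add: points_def lip_linear)
  then show ?thesis by blast
qed

text \<open>If the fourth coordinates had opposite signs, \<open>lip_null_nonpos\<close> for
  \<open>u\<close> and \<open>- v\<close> would give \<open>lip u v \<ge> 0\<close>, against
  \<open>lip u v = - b\<close>.\<close>

lemma edge_side:
  assumes e: "edge q b u v t"
  shows "side q u = side q v"
proof -
  have "u \<noteq> 0" "v \<noteq> 0" using edgeD(6,7)[OF e] by (auto simp: lip_def)
  then have "u$4 \<noteq> 0" "v$4 \<noteq> 0" using null_4_nonzero edgeD[OF e] by blast+
  moreover have "\<not> u$4 * v$4 < 0"
    using lip_null_nonpos[of u "- v"] b_pos by (auto simp: edgeD[OF e] lip_linear)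
  ultimately show ?thesis
    by (auto simp: side_def edgeD[OF e] sgn_if mult_less_0_iff divide_less_0_iff)
qed

text \<open>Pairing the antipodality equation with \<open>u\<close> gives
  \<open>sectional_curvature q * b = 2\<close>, the excluded boundary case.\<close>

lemma edge_not_antipodal:
  assumes e: "edge q b u v t" and K: "sectional_curvature q > 0"
  shows "\<not> antipodal q u v"
proof
  assume "antipodal q u v"
  then have "lip u (u + v) = lip u ((2 / sectional_curvature q) *\<^sub>R q)"
    by (simp add: antipodal_def)
  then show False using K b_less by (simp add: lip_linear edgeD[OF e] field_simps)
qed

end

section \<open>Dependent choice along the integers\<close>

lemma int_dependent_choice:
  fixes P :: "int \<Rightarrow> 'a \<Rightarrow> bool"
  assumes 0: "P 0 x0"
    and fwd: "\<And>i x. P i x \<Longrightarrow> \<exists>y. P (i + 1) y \<and> R i x y"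
    and bwd: "\<And>i y. P (i + 1) y \<Longrightarrow> \<exists>x. P i x \<and> R i x y"
  shows "\<exists>s. \<forall>i. P i (s i) \<and> R i (s i) (s (i + 1))"
proof -
  \<comment> \<open>The clause for \<open>n = 0\<close> pins the start of each ray to
    \<open>x0\<close>, so that the forward and the backward ray can be glued at 0.\<close>
  obtain f where f: "f 0 = x0" "\<And>n. P (int n) (f n)" "\<And>n. R (int n) (f n) (f (Suc n))"
    using dependent_nat_choice[of "\<lambda>n x. P (int n) x \<and> (n = 0 \<longrightarrow> x = x0)" "\<lambda>n. R (int n)"]
      0 fwd[of "int _"] by (auto simp: add.commute)
  have "\<exists>g. \<forall>n. (P (- int n) (g n) \<and> (n = 0 \<longrightarrow> g n = x0)) \<and> R (- int n - 1) (g (Suc n)) (g n)"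
  proof (rule dependent_nat_choice)
    fix x n
    assume "P (- int n) x \<and> (n = 0 \<longrightarrow> x = x0)"
    moreover have "- int (Suc n) = - int n - 1" by simp
    ultimately show "\<exists>y. (P (- int (Suc n)) y \<and> (Suc n = 0 \<longrightarrow> y = x0)) \<and> R (- int n - 1) y x"
      using bwd[of "- int n - 1" x] by (simp only:) simp
  qed (use 0 in simp)
  then obtain g where g: "g 0 = x0" "\<And>n. P (- int n) (g n)"
    "\<And>n. R (- int n - 1) (g (Suc n)) (g n)"
    by blast
  define s where "s i = (if i \<ge> 0 then f (nat i) else g (nat (- i)))" for i
  have "P i (s i) \<and> R i (s i) (s (i + 1))" for i
  proof (cases "i \<ge> 0")
    case True
    then show ?thesis using f(2,3)[of "nat i"] by (simp add: s_def nat_add_distrib)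
  next
    case False
    define n where "n = nat (- i - 1)"
    have i: "i = - int n - 1" using False by (simp add: n_def)
    have "s i = g (Suc n)" using False by (simp add: s_def n_def Suc_nat_eq_nat_zadd1)
    \<comment> \<open>For \<open>n = 0\<close> the index \<open>i + 1\<close> is 0 and
      \<open>s\<close> takes its value from \<open>f\<close>; there
      \<open>f 0 = x0 = g 0\<close>.\<close>
    moreover have "s (i + 1) = g n" using f(1) g(1) by (cases n) (auto simp: s_def i nat_add_distrib)
    moreover have "i = - int (Suc n)" by (simp add: i)
    ultimately show ?thesis using g(2)[of "Suc n"] g(3)[of n] i by metis
  qed
  then show ?thesis by blast
qed

section \<open>Curves as sequences of edges: existence and uniqueness\<close>

context arclength
begin

text \<open>The vertex circle is eliminated by equating its two expressions. The inequality rules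
  out turning back along the same edge, which solves this equation for every
  \<open>\<kappa> i\<close>.\<close>

definition curve_with_curvature ::
  "(int \<Rightarrow> real) \<Rightarrow> (int \<Rightarrow> real^5) \<Rightarrow> (int \<Rightarrow> real^5) \<Rightarrow> bool" where
  "curve_with_curvature \<kappa> f t \<longleftrightarrow> (\<forall>i. edge q b (f i) (f (i + 1)) (t i) \<and> f (i + 1) \<noteq> f (i - 1) \<and>
    (\<kappa> i / 2) *\<^sub>R f (i - 1) + t (i - 1) = (\<kappa> i / 2) *\<^sub>R f (i + 1) + t i)"

lemma curve_with_curvatureD:
  assumes "curve_with_curvature \<kappa> f t"
  shows "edge q b (f i) (f (i + 1)) (t i)" "f (i + 1) \<noteq> f (i - 1)"
    "(\<kappa> i / 2) *\<^sub>R f (i - 1) + t (i - 1) = (\<kappa> i / 2) *\<^sub>R f (i + 1) + t i"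
  using assms unfolding curve_with_curvature_def by blast+

text \<open>Constant distance, the common side and non-antipodality all follow from the edges having
  the same \<open>b\<close>, so only the local conditions remain.\<close>

lemma curve_with_curvature_iff:
  assumes \<eta>: "\<eta>\<^sup>2 = 2 * b"
  shows "curve_with_curvature \<kappa> f t \<longleftrightarrow> (f, t) \<in> curves_arclength q \<eta> \<and> curvature f t = \<kappa>"
proof
  assume c: "curve_with_curvature \<kappa> f t"
  note e = curve_with_curvatureD(1)[OF c]
  have ne: "f i \<noteq> f (i + 1)" for i
    using edgeD(1,4)[OF e[of i]] b_pos by auto
  have "\<forall>i. distance q (f i) (f (i + 1)) = distance q (f 0) (f 1)"
    using edgeD(4)[OF e] edgeD(4)[OF e[of 0]] by (simp add: distance_def)
  moreover have "side q (f i) = side q (f 0)" for i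
  proof (induction i rule: int_induct[of _ 0])
    case (step1 i)
    then show ?case using edge_side[OF e[of i]] by simp
  next
    case (step2 i)
    then show ?case using edge_side[OF e[of "i - 1"]] by simp
  qed simp
  moreover have "vertex_circle f t i (\<kappa> i) ((\<kappa> i / 2) *\<^sub>R f (i + 1) + t i)" for i
    using curve_with_curvatureD(3)[OF c, of i] by (simp add: vertex_circle_def)
  moreover have "f (i - 1) \<noteq> f i \<and> f i \<noteq> f (i + 1) \<and> f (i - 1) \<noteq> f (i + 1)" for i
    using ne[of i] ne[of "i - 1"] curve_with_curvatureD(2)[OF c, of i] by auto
  moreover have "f i \<in> points q" "geodesic_edge q (f i) (f (i + 1)) (t i)" for i
    using e[of i] by (simp_all add: edge_def)
  ultimately have "(f, t) \<in> curves q"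
    using edge_not_antipodal[OF e] unfolding curves_def mem_Collect_eq case_prod_conv by metis
  moreover from this have "curvature f t i = \<kappa> i" for i
    using curve_with_curvatureD(3)[OF c, of i] by (intro curvature_eqI) (auto simp: vertex_circle_def)
  ultimately show "(f, t) \<in> curves_arclength q \<eta> \<and> curvature f t = \<kappa>"
    using edgeD(4)[OF e] \<eta> by (auto simp: curves_arclength_def)
next
  assume "(f, t) \<in> curves_arclength q \<eta> \<and> curvature f t = \<kappa>"
  then have c: "(f, t) \<in> curves q" and \<kappa>: "curvature f t = \<kappa>"
    and b: "\<And>i. lip (f i) (f (i + 1)) = - b"
    using \<eta> by (auto simp: curves_arclength_def)
  have "(\<kappa> i / 2) *\<^sub>R f (i - 1) + t (i - 1) = (\<kappa> i / 2) *\<^sub>R f (i + 1) + t i" for i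
  proof -
    obtain k c where v: "vertex_circle f t i k c" using c by (simp add: curves_def) metis
    have "k = \<kappa> i" using curvature_eqI[OF \<open>(f, t) \<in> curves q\<close> v] \<kappa> by simp
    then show ?thesis using v unfolding vertex_circle_def by metis
  qed
  moreover have "f (i + 1) \<noteq> f (i - 1)" "edge q b (f i) (f (i + 1)) (t i)" for i
  proof -
    have "f (i - 1) \<noteq> f (i + 1)" using c unfolding curves_def by blast
    then show "f (i + 1) \<noteq> f (i - 1)" by simp
    show "edge q b (f i) (f (i + 1)) (t i)" using c b by (auto simp: curves_def edge_def)
  qed
  ultimately show "curve_with_curvature \<kappa> f t" unfolding curve_with_curvature_def by blast
qed

lemma exists_curve:
  assumes e: "edge q b u v t"
  shows "\<exists>f t. curve_with_curvature \<kappa> f t"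
proof -
  let ?P = "\<lambda>i (u, v, t). edge q b u v t"
  \<comment> \<open>Edges \<open>i\<close> and \<open>i + 1\<close> meet at vertex
    \<open>i + 1\<close>, hence the shift in \<open>\<kappa>\<close>.\<close>
  let ?R = "\<lambda>i (u, v, t) (u', v', t'). u' = v \<and> v' \<noteq> u \<and>
    (\<kappa> (i + 1) / 2) *\<^sub>R u + t = (\<kappa> (i + 1) / 2) *\<^sub>R v' + t'"
  have "\<exists>S. \<forall>i. ?P i (S i) \<and> ?R i (S i) (S (i + 1))"
  proof (rule int_dependent_choice)
    show "?P 0 (u, v, t)" using e by simp
    show "\<exists>y. ?P (i + 1) y \<and> ?R i x y" if "?P i x" for i x
    proof -
      obtain u v t where x: "x = (u, v, t)" by (cases x)
      from that have "edge q b u v t" by (simp add: x)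
      from next_edge[OF this, of "\<kappa> (i + 1)"] obtain y s where "edge q b v y s" "y \<noteq> u"
        "(\<kappa> (i + 1) / 2) *\<^sub>R u + t = (\<kappa> (i + 1) / 2) *\<^sub>R y + s" by blast
      then show ?thesis using x by (intro exI[of _ "(v, y, s)"]) auto
    qed
    show "\<exists>x. ?P i x \<and> ?R i x y" if "?P (i + 1) y" for i y
    proof -
      obtain u v t where y: "y = (u, v, t)" by (cases y)
      \<comment> \<open>Swapping the end points turns the backward continuation into an instance of
        \<open>next_edge\<close>.\<close>
      have "edge q b v u t" using that y edge_sym by simp
      from next_edge[OF this, of "\<kappa> (i + 1)"] obtain x s where "edge q b u x s" "x \<noteq> v"
        "(\<kappa> (i + 1) / 2) *\<^sub>R v + t = (\<kappa> (i + 1) / 2) *\<^sub>R x + s" by blast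
      then show ?thesis using y edge_sym by (intro exI[of _ "(x, u, s)"]) auto
    qed
  qed
  then obtain S where S: "\<And>i. ?P i (S i) \<and> ?R i (S i) (S (i + 1))" by blast
  define f t where "f i = fst (S i)" and "t i = snd (snd (S i))" for i
  have Si: "S i = (f i, f (i + 1), t i)" for i
    using S[of i] by (auto simp: f_def t_def split: prod.splits)
  have "edge q b (f i) (f (i + 1)) (t i)" for i
    using S[of i] unfolding Si by simp
  moreover have "f (i + 1) \<noteq> f (i - 1) \<and>
    (\<kappa> i / 2) *\<^sub>R f (i - 1) + t (i - 1) = (\<kappa> i / 2) *\<^sub>R f (i + 1) + t i" for i
    using S[of "i - 1"] unfolding Si by simp
  ultimately show ?thesis unfolding curve_with_curvature_def by blast
qed

text \<open>Induction in both directions from edge 0, with \<open>next_edge_unique\<close> at each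
  vertex; the whole edge is carried along because its orientation is needed too.\<close>

lemma curve_determined_by_edge:
  assumes c: "curve_with_curvature \<kappa> f t" and c': "curve_with_curvature \<kappa> f' t'"
    and 0: "f 0 = f' 0" "f 1 = f' 1" "t 0 = t' 0"
  shows "f i = f' i \<and> f (i + 1) = f' (i + 1) \<and> t i = t' i"
proof (induction i rule: int_induct[of _ 0])
  case base
  then show ?case using 0 by simp
next
  case (step1 i)
  have "f (i + 1 + 1) = f' (i + 1 + 1) \<and> t (i + 1) = t' (i + 1)"
  proof (rule next_edge_unique[where k = "\<kappa> (i + 1)"])
    show "edge q b (f i) (f (i + 1)) (t i)" "edge q b (f (i + 1)) (f (i + 1 + 1)) (t (i + 1))"
      by (rule curve_with_curvatureD(1)[OF c])+
    show "edge q b (f (i + 1)) (f' (i + 1 + 1)) (t' (i + 1))"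
      using curve_with_curvatureD(1)[OF c', of "i + 1"] step1 by simp
    show "f (i + 1 + 1) \<noteq> f i"
      using curve_with_curvatureD(2)[OF c, of "i + 1"] by simp
    show "f' (i + 1 + 1) \<noteq> f i"
      using curve_with_curvatureD(2)[OF c', of "i + 1"] step1 by simp
    show "(\<kappa> (i + 1) / 2) *\<^sub>R f i + t i = (\<kappa> (i + 1) / 2) *\<^sub>R f (i + 1 + 1) + t (i + 1)"
      using curve_with_curvatureD(3)[OF c, of "i + 1"] by simp
    show "(\<kappa> (i + 1) / 2) *\<^sub>R f i + t i = (\<kappa> (i + 1) / 2) *\<^sub>R f' (i + 1 + 1) + t' (i + 1)"
      using curve_with_curvatureD(3)[OF c', of "i + 1"] step1 by simp
  qed
  then show ?case using step1 by simp
next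
  case (step2 i)
  have "f (i - 1) = f' (i - 1) \<and> t (i - 1) = t' (i - 1)"
  proof (rule next_edge_unique[where k = "\<kappa> i"])
    show "edge q b (f (i + 1)) (f i) (t i)"
      using curve_with_curvatureD(1)[OF c] edge_sym by blast
    show "edge q b (f i) (f (i - 1)) (t (i - 1))"
      using curve_with_curvatureD(1)[OF c, of "i - 1"] edge_sym by simp
    show "edge q b (f i) (f' (i - 1)) (t' (i - 1))"
      using curve_with_curvatureD(1)[OF c', of "i - 1"] step2 edge_sym by simp
    show "f (i - 1) \<noteq> f (i + 1)"
      using curve_with_curvatureD(2)[OF c, of i] by simp
    show "f' (i - 1) \<noteq> f (i + 1)"
      using curve_with_curvatureD(2)[OF c', of i] step2 by simp
    show "(\<kappa> i / 2) *\<^sub>R f (i + 1) + t i = (\<kappa> i / 2) *\<^sub>R f (i - 1) + t (i - 1)"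
      using curve_with_curvatureD(3)[OF c, of i] by simp
    show "(\<kappa> i / 2) *\<^sub>R f (i + 1) + t i = (\<kappa> i / 2) *\<^sub>R f' (i - 1) + t' (i - 1)"
      using curve_with_curvatureD(3)[OF c', of i] step2 by simp
  qed
  then show ?case using step2 by simp
qed

lemma motion_curve:
  assumes m: "m \<in> motions q" and c: "curve_with_curvature \<kappa> f t"
  shows "curve_with_curvature \<kappa> (m \<circ> f) (m \<circ> t)"
proof -
  have "(\<kappa> i / 2) *\<^sub>R m (f (i - 1)) + m (t (i - 1)) = (\<kappa> i / 2) *\<^sub>R m (f (i + 1)) + m (t i)" for i
    using arg_cong[OF curve_with_curvatureD(3)[OF c], of m i] motions_linear[OF m]
    by (simp add: linear_add linear_scale)
  moreover have "m (f (i + 1)) \<noteq> m (f (i - 1))" for i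
    using motions_inj[OF m] curve_with_curvatureD(2)[OF c] by (simp add: inj_eq)
  ultimately show ?thesis
    using motions_edge[OF m curve_with_curvatureD(1)[OF c]]
    unfolding curve_with_curvature_def comp_apply by blast
qed

text \<open>A motion matching the edges at 0 preserves the curvature equation, so the moved curve
  and the second curve agree everywhere.\<close>

lemma curve_unique_up_to_motion:
  assumes c: "curve_with_curvature \<kappa> f t" and c': "curve_with_curvature \<kappa> f' t'"
  shows "\<exists>m\<in>motions q. f' = m \<circ> f \<and> t' = m \<circ> t"
proof -
  have "edge q b (f 0) (f 1) (t 0)" "edge q b (f' 0) (f' 1) (t' 0)"
    using curve_with_curvatureD(1)[OF c, of 0] curve_with_curvatureD(1)[OF c', of 0] by simp_all
  from motions_transitive[OF this b_pos] obtain m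
    where m: "m \<in> motions q" "m (f 0) = f' 0" "m (f 1) = f' 1" "m (t 0) = t' 0" by blast
  have "f' = m \<circ> f \<and> t' = m \<circ> t"
    using curve_determined_by_edge[OF motion_curve[OF m(1) c] c'] m(2-4) by auto
  then show ?thesis using m(1) by blast
qed

end

theorem theorem11:
  fixes q :: "real^5" and \<eta> :: real and \<kappa> :: "int \<Rightarrow> real"
  assumes "space_form q" and "admissible q \<eta>"
  shows "(\<exists>f t. (f, t) \<in> curves_arclength q \<eta> \<and> curvature f t = \<kappa>) \<and>
    (\<forall>f t f' t'.
       (f, t) \<in> curves_arclength q \<eta> \<and> curvature f t = \<kappa> \<and>
       (f', t') \<in> curves_arclength q \<eta> \<and> curvature f' t' = \<kappa> \<longrightarrow>
       (\<exists>m\<in>motions q. f' = m \<circ> f \<and> t' = m \<circ> t))"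
proof -
  have \<eta>: "\<eta> > 0" "sectional_curvature q * \<eta>\<^sup>2 < 4"
    using assms(2) by (simp_all add: admissible_def)
  interpret arclength q "\<eta>\<^sup>2 / 2"
    using assms(1) \<eta> by unfold_locales (simp_all add: space_form_def)
  \<comment> \<open>This pair of points provides the initial edge from which the curve is
    grown.\<close>
  obtain u v where "u \<in> points q" "v \<in> points q" "\<eta>\<^sup>2 = - 2 * lip u v"
    using admissible_iff[OF assms(1) \<eta>(1)] assms(2) by blast
  then obtain t where "edge q (\<eta>\<^sup>2 / 2) u v t"
    using exists_geodesic_edge[of u v] by auto
  moreover have "\<eta>\<^sup>2 = 2 * (\<eta>\<^sup>2 / 2)" by simp
  note iff = curve_with_curvature_iff[OF this]
  ultimately show ?thesis
    using exists_curve[of u v t \<kappa>] curve_unique_up_to_motion[of \<kappa>] unfolding iff by blast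
qed

end
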